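(* Let $\varepsilon>0$ and $\eta\in\mathbb R$. For any $\Delta t>0$, the scheme $$\frac{U^{(n+1)}-U^{(n)}}{\Delta t}=\begin{cases}-\left[(U^{(n)})^3+\left\{(1-\eta)U^{(n+1)}+\varepsilon\Delta_{\mathrm d}^2U^{(n+1)}\right\}+2\Delta_{\mathrm d}U^{(n)}\right]&(\eta<1),\\-\left[(U^{(n)})^3+\varepsilon\Delta_{\mathrm d}^2U^{(n+1)}-\left\{(\eta-1)U^{(n)}-2\Delta_{\mathrm d}U^{(n)}\right\}\right]&(\eta\ge1),\end{cases}$$ with the discrete Neumann boundary conditions imposed on every $U^{(n)}$, admits a unique solution at each time step; that is, for every $U^{(n)}\in L_{\mathrm d}^2$ there is exactly one $U^{(n+1)}\in L_{\mathrm d}^2$ satisfying it.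
   Context: Fix lengths $\ell_x,\ell_y,\ell_z>0$, positive integers $N_x,N_y,N_z$, and mesh sizes $\Delta x=\ell_x/N_x$, $\Delta y=\ell_y/N_y$, $\Delta z=\ell_z/N_z$. $L_{\mathrm d}^2$ is the real vector space of arrays $U=(U_{i,j,k})$ with $0\le i\le N_x$, $0\le j\le N_y$, $0\le k\le N_z$. Difference operators: $\delta_i^+f_{i,j,k}=\frac{f_{i+1,j,k}-f_{i,j,k}}{\Delta x}$, $\delta_i^-f_{i,j,k}=\frac{f_{i,j,k}-f_{i-1,j,k}}{\Delta x}$, $\delta_i^{\langle1\rangle}f_{i,j,k}=\frac{f_{i+1,j,k}-f_{i-1,j,k}}{2\Delta x}$, and analogously $\delta_j^{\pm},\delta_j^{\langle1\rangle}$ (with $\Delta y$) and $\delta_k^{\pm},\delta_k^{\langle1\rangle}$ (with $\Delta z$). The discrete Laplacian is $\Delta_{\mathrm d}=\delta_i^+\delta_i^-+\delta_j^+\delta_j^-+\delta_k^+\delta_k^-$, and $\Delta_{\mathrm d}^2=\Delta_{\mathrm d}\Delta_{\mathrm d}$. The cube $U^3$ is taken entrywise. Discrete Neumann boundary conditions: $\delta_i^{\langle1\rangle}U_{i,j,k}=0$ and $\delta_i^{\langle1\rangle}\Delta_{\mathrm d}U_{i,j,k}=0$ at $i=0$ and $i=N_x$; $\delta_j^{\langle1\rangle}U_{i,j,k}=0$ and $\delta_j^{\langle1\rangle}\Delta_{\mathrm d}U_{i,j,k}=0$ at $j=0$ and $j=N_y$; $\delta_k^{\langle1\rangle}U_{i,j,k}=0$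 and $\delta_k^{\langle1\rangle}\Delta_{\mathrm d}U_{i,j,k}=0$ at $k=0$ and $k=N_z$. These determine the values of $U$ at the exterior (ghost) indices needed by the operators: they amount to even reflection in each index, $U_{-p,j,k}=U_{p,j,k}$, $U_{N_x+p,j,k}=U_{N_x-p,j,k}$ for $p=1,2$, and similarly in $j$ and $k$. Elements of $L_{\mathrm d}^2$ are extended in this way whenever difference operators are applied. *)

theory Defs
  imports Complex_Main
begin

text \<open>
  A grid function carries integer indices, so that difference operators may refer to
  exterior (ghost) indices.
\<close>

type_synonym grid_fun = "int \<Rightarrow> int \<Rightarrow> int \<Rightarrow> real"

definition diff_fwd_i :: "real \<Rightarrow> grid_fun \<Rightarrow> grid_fun" where
  "diff_fwd_i h f = (\<lambda>i j k. (f (i + 1) j k - f i j k) / h)"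

definition diff_bwd_i :: "real \<Rightarrow> grid_fun \<Rightarrow> grid_fun" where
  "diff_bwd_i h f = (\<lambda>i j k. (f i j k - f (i - 1) j k) / h)"

definition diff_ctr_i :: "real \<Rightarrow> grid_fun \<Rightarrow> grid_fun" where
  "diff_ctr_i h f = (\<lambda>i j k. (f (i + 1) j k - f (i - 1) j k) / (2 * h))"

definition diff_fwd_j :: "real \<Rightarrow> grid_fun \<Rightarrow> grid_fun" where
  "diff_fwd_j h f = (\<lambda>i j k. (f i (j + 1) k - f i j k) / h)"

definition diff_bwd_j :: "real \<Rightarrow> grid_fun \<Rightarrow> grid_fun" where
  "diff_bwd_j h f = (\<lambda>i j k. (f i j k - f i (j - 1) k) / h)"

definition diff_ctr_j :: "real \<Rightarrow> grid_fun \<Rightarrow> grid_fun" where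
  "diff_ctr_j h f = (\<lambda>i j k. (f i (j + 1) k - f i (j - 1) k) / (2 * h))"

definition diff_fwd_k :: "real \<Rightarrow> grid_fun \<Rightarrow> grid_fun" where
  "diff_fwd_k h f = (\<lambda>i j k. (f i j (k + 1) - f i j k) / h)"

definition diff_bwd_k :: "real \<Rightarrow> grid_fun \<Rightarrow> grid_fun" where
  "diff_bwd_k h f = (\<lambda>i j k. (f i j k - f i j (k - 1)) / h)"

definition diff_ctr_k :: "real \<Rightarrow> grid_fun \<Rightarrow> grid_fun" where
  "diff_ctr_k h f = (\<lambda>i j k. (f i j (k + 1) - f i j (k - 1)) / (2 * h))"

definition laplace_d :: "real \<Rightarrow> real \<Rightarrow> real \<Rightarrow> grid_fun \<Rightarrow> grid_fun" where
  "laplace_d dx dy dz f =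
     (\<lambda>i j k. diff_fwd_i dx (diff_bwd_i dx f) i j k
            + diff_fwd_j dy (diff_bwd_j dy f) i j k
            + diff_fwd_k dz (diff_bwd_k dz f) i j k)"

text \<open>
  An array indexed by \<open>0 \<le> i \<le> Nx\<close>, \<open>0 \<le> j \<le> Ny\<close>, \<open>0 \<le> k \<le> Nz\<close> is represented by the grid
  function with these entries that vanishes at all other indices. The zeros are only padding,
  so that equality of arrays is equality of functions; the values used at ghost indices are
  those of \<open>neumann_ext\<close> below.
\<close>

definition L2d :: "nat \<Rightarrow> nat \<Rightarrow> nat \<Rightarrow> grid_fun set" where
  "L2d Nx Ny Nz =
     {U. \<forall>i j k. \<not> (i \<in> {0..int Nx} \<and> j \<in> {0..int Ny} \<and> k \<in> {0..int Nz}) \<longrightarrow> U i j k = 0}"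

definition discrete_neumann ::
  "nat \<Rightarrow> nat \<Rightarrow> nat \<Rightarrow> real \<Rightarrow> real \<Rightarrow> real \<Rightarrow> grid_fun \<Rightarrow> bool" where
  "discrete_neumann Nx Ny Nz dx dy dz W \<longleftrightarrow>
     (\<forall>i\<in>{0, int Nx}. \<forall>j k.
        diff_ctr_i dx W i j k = 0 \<and> diff_ctr_i dx (laplace_d dx dy dz W) i j k = 0) \<and>
     (\<forall>j\<in>{0, int Ny}. \<forall>i k.
        diff_ctr_j dy W i j k = 0 \<and> diff_ctr_j dy (laplace_d dx dy dz W) i j k = 0) \<and>
     (\<forall>k\<in>{0, int Nz}. \<forall>i j.
        diff_ctr_k dz W i j k = 0 \<and> diff_ctr_k dz (laplace_d dx dy dz W) i j k = 0)"

text \<open>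
  \<open>reflect N\<close> folds an index into \<open>{0..N}\<close> by repeated reflection at \<open>0\<close> and \<open>N\<close>; repetition
  matters already within the two ghost layers when \<open>N = 1\<close>.
\<close>

definition reflect :: "nat \<Rightarrow> int \<Rightarrow> int" where
  "reflect N i = (let m = i mod (2 * int N) in if m \<le> int N then m else 2 * int N - m)"

definition neumann_ext :: "nat \<Rightarrow> nat \<Rightarrow> nat \<Rightarrow> grid_fun \<Rightarrow> grid_fun" where
  "neumann_ext Nx Ny Nz U = (\<lambda>i j k. U (reflect Nx i) (reflect Ny j) (reflect Nz k))"

text \<open>One time step of the scheme, from \<open>U\<close> to \<open>V\<close>.\<close>

definition scheme_step ::
  "nat \<Rightarrow> nat \<Rightarrow> nat \<Rightarrow> real \<Rightarrow> real \<Rightarrow> real \<Rightarrow> real \<Rightarrow> real \<Rightarrow> real \<Rightarrow> grid_fun \<Rightarrow> grid_fun \<Rightarrow> bool"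
where
  "scheme_step Nx Ny Nz dx dy dz \<epsilon> \<eta> dt U V \<longleftrightarrow>
     (let E = neumann_ext Nx Ny Nz; L = laplace_d dx dy dz in
      \<forall>i\<in>{0..int Nx}. \<forall>j\<in>{0..int Ny}. \<forall>k\<in>{0..int Nz}.
        (V i j k - U i j k) / dt =
          (if \<eta> < 1
           then - ((U i j k) ^ 3
                   + ((1 - \<eta>) * V i j k + \<epsilon> * L (L (E V)) i j k)
                   + 2 * L (E U) i j k)
           else - ((U i j k) ^ 3
                   + \<epsilon> * L (L (E V)) i j k
                   - ((\<eta> - 1) * U i j k - 2 * L (E U) i j k))))"

text \<open>
  The remaining facts justify the use of \<open>neumann_ext\<close>: it is the extension that the discrete
  Neumann boundary conditions prescribe on the two ghost layers reached by the squared Laplacian.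
\<close>

lemma discrete_neumann_iff:
  assumes "dx \<noteq> 0" "dy \<noteq> 0" "dz \<noteq> 0"
  shows "discrete_neumann Nx Ny Nz dx dy dz W \<longleftrightarrow>
     (\<forall>p\<in>{1,2}. \<forall>i j k.
        W (- p) j k = W p j k \<and> W (int Nx + p) j k = W (int Nx - p) j k \<and>
        W i (- p) k = W i p k \<and> W i (int Ny + p) k = W i (int Ny - p) k \<and>
        W i j (- p) = W i j p \<and> W i j (int Nz + p) = W i j (int Nz - p))"
    (is "_ \<longleftrightarrow> ?R")
proof -
  have aux: "(\<forall>j k. diff_ctr_i dx W a j k = 0 \<and> diff_ctr_i dx (laplace_d dx dy dz W) a j k = 0)
     \<longleftrightarrow> (\<forall>j k. W (a+1) j k = W (a-1) j k \<and> W (a+2) j k = W (a-2) j k)" for a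
  proof -
    have "(\<forall>j k. diff_ctr_i dx W a j k = 0) \<longleftrightarrow> (\<forall>j k. W (a+1) j k = W (a-1) j k)"
      using assms by (simp add: diff_ctr_i_def)
    moreover have "diff_ctr_i dx (laplace_d dx dy dz W) a j k = 0 \<longleftrightarrow> W (a+2) j k = W (a-2) j k"
      if "\<forall>j k. W (a+1) j k = W (a-1) j k" for j k
      using assms that
      by (simp add: diff_ctr_i_def laplace_d_def diff_fwd_i_def diff_bwd_i_def diff_fwd_j_def
          diff_bwd_j_def diff_fwd_k_def diff_bwd_k_def field_simps)
    ultimately show ?thesis by blast
  qed
  have auy: "(\<forall>i k. diff_ctr_j dy W i a k = 0 \<and> diff_ctr_j dy (laplace_d dx dy dz W) i a k = 0)
     \<longleftrightarrow> (\<forall>i k. W i (a+1) k = W i (a-1) k \<and> W i (a+2) k = W i (a-2) k)" for a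
  proof -
    have "(\<forall>i k. diff_ctr_j dy W i a k = 0) \<longleftrightarrow> (\<forall>i k. W i (a+1) k = W i (a-1) k)"
      using assms by (simp add: diff_ctr_j_def)
    moreover have "diff_ctr_j dy (laplace_d dx dy dz W) i a k = 0 \<longleftrightarrow> W i (a+2) k = W i (a-2) k"
      if "\<forall>i k. W i (a+1) k = W i (a-1) k" for i k
      using assms that
      by (simp add: diff_ctr_j_def laplace_d_def diff_fwd_i_def diff_bwd_i_def diff_fwd_j_def
          diff_bwd_j_def diff_fwd_k_def diff_bwd_k_def field_simps)
    ultimately show ?thesis by blast
  qed
  have auz: "(\<forall>i j. diff_ctr_k dz W i j a = 0 \<and> diff_ctr_k dz (laplace_d dx dy dz W) i j a = 0)
     \<longleftrightarrow> (\<forall>i j. W i j (a+1) = W i j (a-1) \<and> W i j (a+2) = W i j (a-2))" for a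
  proof -
    have "(\<forall>i j. diff_ctr_k dz W i j a = 0) \<longleftrightarrow> (\<forall>i j. W i j (a+1) = W i j (a-1))"
      using assms by (simp add: diff_ctr_k_def)
    moreover have "diff_ctr_k dz (laplace_d dx dy dz W) i j a = 0 \<longleftrightarrow> W i j (a+2) = W i j (a-2)"
      if "\<forall>i j. W i j (a+1) = W i j (a-1)" for i j
      using assms that
      by (simp add: diff_ctr_k_def laplace_d_def diff_fwd_i_def diff_bwd_i_def diff_fwd_j_def
          diff_bwd_j_def diff_fwd_k_def diff_bwd_k_def field_simps)
    ultimately show ?thesis by blast
  qed
  show ?thesis
    unfolding discrete_neumann_def ball_simps aux auy auz by (simp; metis)
qed

lemma reflect_id: "i \<in> {0..int N} \<Longrightarrow> reflect N i = i"
  by (cases "N = 0") (auto simp: reflect_def Let_def)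

lemma reflect_minus: "reflect N (- i) = reflect N i"
  by (auto simp: reflect_def Let_def zmod_zminus1_eq_if)

lemma reflect_upper: "reflect N (int N + i) = reflect N (int N - i)"
proof -
  have "int N - i = - (int N + i) + 2 * int N" by simp
  then have "reflect N (int N - i) = reflect N (- (int N + i))"
    unfolding reflect_def by (metis mod_add_self2)
  then show ?thesis by (simp only: reflect_minus)
qed

lemma neumann_ext_on_grid:
  assumes "i \<in> {0..int Nx}" "j \<in> {0..int Ny}" "k \<in> {0..int Nz}"
  shows "neumann_ext Nx Ny Nz U i j k = U i j k"
  using assms by (simp add: neumann_ext_def reflect_id)

lemma discrete_neumann_neumann_ext:
  assumes "dx \<noteq> 0" "dy \<noteq> 0" "dz \<noteq> 0"
  shows "discrete_neumann Nx Ny Nz dx dy dz (neumann_ext Nx Ny Nz U)"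
  unfolding discrete_neumann_iff[OF assms] neumann_ext_def
  by (simp only: reflect_minus reflect_upper) simp

lemma even_ghost_eq_reflect:
  fixes f :: "int \<Rightarrow> real"
  assumes "N > 0" and i: "i \<in> {-2..int N + 2}"
    and f: "\<And>p. p \<in> {1,2} \<Longrightarrow> f (- p) = f p \<and> f (int N + p) = f (int N - p)"
  shows "f i = f (reflect N i)"
proof -
  have *: "f (-1) = f 1" "f (-2) = f 2" "f (int N + 1) = f (int N - 1)" "f (int N + 2) = f (int N - 2)"
    using f[of 1] f[of 2] by auto
  consider "i \<in> {0..int N}" | "i = -1" | "i = -2" | "i = int N + 1" | "i = int N + 2"
    using i by force
  then show ?thesis
  proof cases
    case 1 then show ?thesis by (simp add: reflect_id)
  next
    case 2 then show ?thesis
      using * reflect_minus[of N 1] reflect_id[of 1 N] \<open>N > 0\<close> by simp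
  next
    case 3 show ?thesis
    proof (cases "N = 1")
      case True then show ?thesis using 3 * by (simp add: reflect_def)
    next
      case False then show ?thesis
        using 3 * reflect_minus[of N 2] reflect_id[of 2 N] \<open>N > 0\<close> by simp
    qed
  next
    case 4 then show ?thesis
      using * reflect_upper[of N 1] reflect_id[of "int N - 1" N] \<open>N > 0\<close> by simp
  next
    case 5 show ?thesis
    proof (cases "N = 1")
      case True then show ?thesis using 5 * by (simp add: reflect_def)
    next
      case False then show ?thesis
        using 5 * reflect_upper[of N 2] reflect_id[of "int N - 2" N] \<open>N > 0\<close> by simp
    qed
  qed
qed

lemma reflect_range: "N > 0 \<Longrightarrow> reflect N i \<in> {0..int N}"
  using pos_mod_bound[of "2 * int N" i] pos_mod_sign[of "2 * int N" i]
  by (auto simp: reflect_def Let_def simp del: pos_mod_bound pos_mod_sign)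

lemma discrete_neumann_determines_ghosts:
  assumes "Nx > 0" "Ny > 0" "Nz > 0" and d: "dx \<noteq> 0" "dy \<noteq> 0" "dz \<noteq> 0"
    and W: "discrete_neumann Nx Ny Nz dx dy dz W"
    and WU: "\<And>i j k. i \<in> {0..int Nx} \<Longrightarrow> j \<in> {0..int Ny} \<Longrightarrow> k \<in> {0..int Nz} \<Longrightarrow> W i j k = U i j k"
    and i: "i \<in> {-2..int Nx + 2}" and j: "j \<in> {-2..int Ny + 2}" and k: "k \<in> {-2..int Nz + 2}"
  shows "W i j k = neumann_ext Nx Ny Nz U i j k"
proof -
  note R = W[unfolded discrete_neumann_iff[OF d]]
  have "W i j k = W (reflect Nx i) j k"
    using R by (intro even_ghost_eq_reflect[of _ _ "\<lambda>i. W i j k"] assms) blast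
  also have "\<dots> = W (reflect Nx i) (reflect Ny j) k"
    using R by (intro even_ghost_eq_reflect[of _ _ "\<lambda>j. W _ j k"] assms) blast
  also have "\<dots> = W (reflect Nx i) (reflect Ny j) (reflect Nz k)"
    using R by (intro even_ghost_eq_reflect[of _ _ "\<lambda>k. W _ _ k"] assms) blast
  also have "\<dots> = neumann_ext Nx Ny Nz U i j k"
    using assms(1-3) by (simp add: neumann_ext_def WU reflect_range del: atLeastAtMost_iff)
  finally show ?thesis .
qed

end

theory Submission
  imports Defs "HOL-Library.Function_Algebras"
begin

text \<open>
  In either case one time step is a linear system \<open>(a I + \<epsilon> A) V = F\<close> on the grid, where \<open>a > 0\<close>
  and \<open>A\<close> is the squared Laplacian of the Neumann extension, so uniqueness implies existence.
  The extension is even and periodic with periods \<open>2 Nx\<close>, \<open>2 Ny\<close>, \<open>2 Nz\<close>, and so are its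
  Laplacians; hence a homogeneous solution satisfies the equation at all integer indices. Over
  a full period the Laplacian is symmetric without boundary terms or weights, and testing with
  the solution \<open>W\<close> gives \<open>a \<Sum> W\<^sup>2 + \<epsilon> \<Sum> (L W)\<^sup>2 = 0\<close>.
\<close>

subsection \<open>Linear systems on a finite index set\<close>

text \<open>An injective endomorphism of a finite-dimensional space is onto. The space consists of
  the functions supported in \<open>S\<close>, with the point indicators as basis; their images are
  independent and equally many, so they span it too.\<close>

lemma finite_support_linear_surj:
  fixes T :: "('a \<Rightarrow> real) \<Rightarrow> 'a \<Rightarrow> real"
  assumes fin: "finite S"
    and add: "\<And>f g. T (\<lambda>x. f x + g x) = (\<lambda>x. T f x + T g x)"
    and scl: "\<And>c f. T (\<lambda>x. c * f x) = (\<lambda>x. c * T f x)"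
    and supp: "\<And>f x. x \<notin> S \<Longrightarrow> T f x = 0"
    and ker: "\<And>f. (\<And>x. x \<notin> S \<Longrightarrow> f x = 0) \<Longrightarrow> T f = (\<lambda>x. 0) \<Longrightarrow> f = (\<lambda>x. 0)"
    and g: "\<And>x. x \<notin> S \<Longrightarrow> g x = 0"
  shows "\<exists>f. (\<forall>x. x \<notin> S \<longrightarrow> f x = 0) \<and> T f = g"
proof -
  \<comment> \<open>Addition of functions is the pointwise instance from
    \<open>Function_Algebras\<close>; an explicit scaling lets the locale
    \<open>vector_space\<close> be interpreted on this type.\<close>
  define sc :: "real \<Rightarrow> ('a \<Rightarrow> real) \<Rightarrow> 'a \<Rightarrow> real" where "sc = (\<lambda>c f x. c * f x)"
  define e :: "'a \<Rightarrow> 'a \<Rightarrow> real" where "e = (\<lambda>p x. if x = p then 1 else 0)"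
  define B where "B = e ` S"
  interpret V: vector_space sc
    by unfold_locales (auto simp: sc_def plus_fun_def algebra_simps)
  interpret P: vector_space_pair sc sc ..
  have lin: "Vector_Spaces.linear sc sc T"
    by unfold_locales (auto simp: add scl sc_def plus_fun_def)
  have finB: "finite B"
    using fin by (simp add: B_def)
  have sub: "V.subspace {f. \<forall>x. x \<notin> S \<longrightarrow> f x = 0}"
    unfolding V.subspace_def by (auto simp: sc_def plus_fun_def zero_fun_def)
  have sum_app: "(\<Sum>p\<in>A. F p) x = (\<Sum>p\<in>A. F p x)" if "finite A"
    for A :: "'a set" and F :: "'a \<Rightarrow> 'a \<Rightarrow> real" and x
    using that by (induction rule: finite_induct) (auto simp: plus_fun_def zero_fun_def)
  have expand: "f = (\<Sum>p\<in>S. sc (f p) (e p))" if "\<forall>x. x \<notin> S \<longrightarrow> f x = 0" for f :: "'a \<Rightarrow> real"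
  proof
    fix x
    show "f x = (\<Sum>p\<in>S. sc (f p) (e p)) x"
      using that fin by (simp add: sum_app sc_def e_def if_distrib cong: if_cong)
  qed
  have span: "V.span B = {f. \<forall>x. x \<notin> S \<longrightarrow> f x = 0}"
  proof
    show "V.span B \<subseteq> {f. \<forall>x. x \<notin> S \<longrightarrow> f x = 0}"
      by (rule V.span_minimal[OF _ sub]) (auto simp: B_def e_def)
    show "{f. \<forall>x. x \<notin> S \<longrightarrow> f x = 0} \<subseteq> V.span B"
    proof
      fix f :: "'a \<Rightarrow> real" assume "f \<in> {f. \<forall>x. x \<notin> S \<longrightarrow> f x = 0}"
      then have *: "f = (\<Sum>p\<in>S. sc (f p) (e p))"
        using expand by auto
      show "f \<in> V.span B"
        by (subst *, intro V.span_sum V.span_scale, rule V.span_base) (simp add: B_def)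
    qed
  qed
  have inje: "inj_on e S"
    by (auto simp: inj_on_def e_def fun_eq_iff split: if_splits)
  have indB: "V.independent B"
  proof (subst V.independent_explicit_finite_subsets, intro allI impI ballI)
    fix A u b assume A: "A \<subseteq> B" "finite A" and s0: "(\<Sum>v\<in>A. sc (u v) v) = 0" and b: "b \<in> A"
    obtain Q where Q: "Q \<subseteq> S" "A = e ` Q"
      using A(1) by (auto simp: B_def subset_image_iff)
    have finQ: "finite Q"
      using Q fin finite_subset by blast
    obtain q where q: "q \<in> Q" "b = e q"
      using b Q by auto
    \<comment> \<open>Evaluation at \<open>q\<close> isolates the coefficient of the indicator
      \<open>e q\<close>.\<close>
    have "0 = (\<Sum>v\<in>A. sc (u v) v) q"
      by (simp add: s0)
    also have "\<dots> = (\<Sum>p\<in>Q. sc (u (e p)) (e p)) q"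
      using inj_on_subset[OF inje Q(1)] by (simp add: Q(2) sum.reindex)
    also have "\<dots> = u b"
      using finQ q by (simp add: sum_app sc_def e_def if_distrib cong: if_cong)
    finally show "u b = 0" by simp
  qed
  have injT: "inj_on T (V.span B)"
  proof (rule inj_onI)
    fix f h assume f: "f \<in> V.span B" and h: "h \<in> V.span B" and eq: "T f = T h"
    have "T (\<lambda>x. f x + (-1) * h x) = (\<lambda>x. T f x + (-1) * T h x)"
      by (simp only: add scl)
    then have "(\<lambda>x. f x + (-1) * h x) = (\<lambda>x. 0)"
      using f h eq by - (rule ker, auto simp: span)
    then show "f = h"
      by (auto simp: fun_eq_iff)
  qed
  have indT: "V.independent (T ` B)"
    by (rule P.linear_independent_injective_image[OF lin indB injT])
  have TB: "T ` B \<subseteq> V.span B"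
    using supp by (auto simp: span)
  have cardT: "card (T ` B) = card B"
    by (rule card_image[OF inj_on_subset[OF injT V.span_superset]])
  have gB: "g \<in> V.span B"
    using g by (simp add: span)
  have "g \<in> V.span (T ` B)"
  proof (rule ccontr)
    assume n: "g \<notin> V.span (T ` B)"
    then have "V.independent (insert g (T ` B))"
      by (rule V.independent_insertI[OF _ indT])
    then have "card (insert g (T ` B)) \<le> card B"
      using V.independent_span_bound[OF finB, of "insert g (T ` B)"] TB gB by simp
    moreover have "g \<notin> T ` B"
      using n V.span_base by blast
    ultimately show False
      using cardT finB by simp
  qed
  also have "V.span (T ` B) = T ` V.span B"
    by (rule P.linear_span_image[OF lin])
  finally show ?thesis
    by (auto simp: span)
qed

subsection \<open>Even periodic grid functions\<close>

text \<open>Evenness about the far end \<open>N\<close> need not be listed: it follows from evenness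
  about 0 and the period \<open>2 * N\<close>.\<close>

definition even_periodic :: "nat \<Rightarrow> nat \<Rightarrow> nat \<Rightarrow> grid_fun \<Rightarrow> bool" where
  "even_periodic Nx Ny Nz f \<longleftrightarrow>
     (\<forall>i j k. f (- i) j k = f i j k \<and> f (i + 2 * int Nx) j k = f i j k \<and>
              f i (- j) k = f i j k \<and> f i (j + 2 * int Ny) k = f i j k \<and>
              f i j (- k) = f i j k \<and> f i j (k + 2 * int Nz) = f i j k)"

lemma periodic_mod:
  fixes h :: "int \<Rightarrow> real"
  assumes "\<And>i. h (i + M) = h i"
  shows "h (i mod M) = h i"
proof -
  have nat: "h (i + int n * M) = h i" for i n
  proof (induction n)
    case (Suc n)
    then show ?case
      using assms[of "i + int n * M"] by (simp add: algebra_simps)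
  qed simp
  have "h (i + q * M) = h i" for q
  proof (cases "q \<ge> 0")
    case True
    then show ?thesis using nat[of i "nat q"] by simp
  next
    case False
    then show ?thesis using nat[of "i + q * M" "nat (- q)"] by (simp add: algebra_simps)
  qed
  from this[of "- (i div M)"] show ?thesis
    by (simp add: minus_div_mult_eq_mod [symmetric])
qed

lemma even_periodic_reflect:
  fixes h :: "int \<Rightarrow> real"
  assumes "\<And>i. h (- i) = h i" and per: "\<And>i. h (i + 2 * int N) = h i"
  shows "h (reflect N i) = h i"
proof -
  have "h (2 * int N - m) = h m" for m
    using per[of "- m"] assms(1)[of m] by simp
  then show ?thesis
    using periodic_mod[of h "2 * int N", OF per] by (simp add: reflect_def Let_def)
qed

text \<open>Folding invariance carries an identity between even periodic functions from the grid to
  all integer indices.\<close>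

lemma even_periodic_reflect3:
  assumes "even_periodic Nx Ny Nz f"
  shows "f (reflect Nx i) (reflect Ny j) (reflect Nz k) = f i j k"
  using assms even_periodic_reflect[of "\<lambda>i. f i (reflect Ny j) (reflect Nz k)" Nx i]
    even_periodic_reflect[of "\<lambda>j. f i j (reflect Nz k)" Ny j]
    even_periodic_reflect[of "\<lambda>k. f i j k" Nz k]
  by (simp add: even_periodic_def)

lemma even_periodic_neumann_ext: "even_periodic Nx Ny Nz (neumann_ext Nx Ny Nz U)"
  by (simp add: even_periodic_def neumann_ext_def reflect_minus)
     (simp add: reflect_def)

lemma laplace_d_eq:
  "laplace_d dx dy dz f i j k =
     (f (i + 1) j k - 2 * f i j k + f (i - 1) j k) / dx\<^sup>2
   + (f i (j + 1) k - 2 * f i j k + f i (j - 1) k) / dy\<^sup>2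
   + (f i j (k + 1) - 2 * f i j k + f i j (k - 1)) / dz\<^sup>2"
  by (simp add: laplace_d_def diff_fwd_i_def diff_bwd_i_def diff_fwd_j_def diff_bwd_j_def
      diff_fwd_k_def diff_bwd_k_def power2_eq_square diff_divide_distrib add_divide_distrib)

text \<open>A reflection swaps the two neighbours in each second difference, and a translation by a
  period moves both together, so the stencil respects both symmetries.\<close>

lemma even_periodic_laplace_d:
  assumes "even_periodic Nx Ny Nz f"
  shows "even_periodic Nx Ny Nz (laplace_d dx dy dz f)"
proof -
  \<comment> \<open>These forms exhibit a neighbour index as a negated or translated index, to which
    the hypothesis applies directly.\<close>
  have idx: "- x - 1 = - (x + 1)" "1 - x = - (x - 1)"
    "x + 2 * y + 1 = (x + 1) + 2 * y" "x + 2 * y - 1 = (x - 1) + 2 * y" for x y :: int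
    by simp_all
  have neg: "f (1 - i) j k = f (i - 1) j k" "f (- i - 1) j k = f (i + 1) j k"
    "f i (1 - j) k = f i (j - 1) k" "f i (- j - 1) k = f i (j + 1) k"
    "f i j (1 - k) = f i j (k - 1)" "f i j (- k - 1) = f i j (k + 1)" for i j k
    unfolding idx(1,2) using assms by (simp_all only: even_periodic_def)
  have per: "f (i + 2 * int Nx + 1) j k = f (i + 1) j k" "f (i + 2 * int Nx - 1) j k = f (i - 1) j k"
    "f i (j + 2 * int Ny + 1) k = f i (j + 1) k" "f i (j + 2 * int Ny - 1) k = f i (j - 1) k"
    "f i j (k + 2 * int Nz + 1) = f i j (k + 1)" "f i j (k + 2 * int Nz - 1) = f i j (k - 1)"
    for i j k
    unfolding idx(3,4) using assms by (simp_all only: even_periodic_def)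
  show ?thesis
    using assms unfolding even_periodic_def laplace_d_eq
    by (simp add: neg per)
qed

section \<open>Sums over a full period and symmetry of the Laplacian\<close>

text \<open>A half-open period meets each residue class once. Along each axis the interior grid
  indices are thus counted twice and the two end indices once, which builds the boundary weights
  into an unweighted sum.\<close>

definition period_sum :: "nat \<Rightarrow> nat \<Rightarrow> nat \<Rightarrow> grid_fun \<Rightarrow> real" where
  "period_sum Nx Ny Nz F =
     (\<Sum>i\<in>{0..<2 * int Nx}. \<Sum>j\<in>{0..<2 * int Ny}. \<Sum>k\<in>{0..<2 * int Nz}. F i j k)"

lemma sum_periodic_shift:
  fixes h :: "int \<Rightarrow> real"
  assumes "\<And>i. h (i + M) = h i" and "M \<ge> 0"
  shows "(\<Sum>i\<in>{0..<M}. h (i + 1)) = (\<Sum>i\<in>{0..<M}. h i)"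
proof -
  have "(\<Sum>i\<in>{0..<M}. h (i + 1)) = (\<Sum>i\<in>{1..<M + 1}. h i)"
    by (rule sum.reindex_bij_witness[of _ "\<lambda>i. i - 1" "\<lambda>i. i + 1"]) auto
  \<comment> \<open>Both index sets are \<open>{0..M}\<close>, so the two sums can differ only by
    the equal end values \<open>h 0\<close> and \<open>h M\<close>.\<close>
  moreover have "(\<Sum>i\<in>insert 0 {1..<M + 1}. h i) = (\<Sum>i\<in>insert M {0..<M}. h i)"
    using \<open>M \<ge> 0\<close> by (intro sum.cong) auto
  moreover have "h M = h 0"
    using assms(1)[of 0] by simp
  ultimately show ?thesis by simp
qed

text \<open>The left integrand is the right one moved one step along the axis: the flux leaving a
  cell enters its neighbour. Over a period the shift does not change the sum.\<close>

lemma period_sum_shift: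
  assumes "even_periodic Nx Ny Nz f" "even_periodic Nx Ny Nz g"
  shows "period_sum Nx Ny Nz (\<lambda>i j k. f (i + 1) j k * g i j k - f i j k * g (i + 1) j k) =
         period_sum Nx Ny Nz (\<lambda>i j k. f i j k * g (i - 1) j k - f (i - 1) j k * g i j k)"
    and "period_sum Nx Ny Nz (\<lambda>i j k. f i (j + 1) k * g i j k - f i j k * g i (j + 1) k) =
         period_sum Nx Ny Nz (\<lambda>i j k. f i j k * g i (j - 1) k - f i (j - 1) k * g i j k)"
    and "period_sum Nx Ny Nz (\<lambda>i j k. f i j (k + 1) * g i j k - f i j k * g i j (k + 1)) =
         period_sum Nx Ny Nz (\<lambda>i j k. f i j k * g i j (k - 1) - f i j (k - 1) * g i j k)"
proof -
  have per: "u (i + 2 * int Nx) j k = u i j k" "u (i + 2 * int Nx - 1) j k = u (i - 1) j k"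
    "u i (j + 2 * int Ny) k = u i j k" "u i (j + 2 * int Ny - 1) k = u i (j - 1) k"
    "u i j (k + 2 * int Nz) = u i j k" "u i j (k + 2 * int Nz - 1) = u i j (k - 1)"
    if "even_periodic Nx Ny Nz u" for u i j k
    using that[unfolded even_periodic_def, rule_format, of i j k]
      that[unfolded even_periodic_def, rule_format, of "i - 1" j k]
      that[unfolded even_periodic_def, rule_format, of i "j - 1" k]
      that[unfolded even_periodic_def, rule_format, of i j "k - 1"]
    by (simp_all add: algebra_simps)
  note per = per[OF assms(1)] per[OF assms(2)]
  show "period_sum Nx Ny Nz (\<lambda>i j k. f (i + 1) j k * g i j k - f i j k * g (i + 1) j k) =
         period_sum Nx Ny Nz (\<lambda>i j k. f i j k * g (i - 1) j k - f (i - 1) j k * g i j k)"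
    unfolding period_sum_def
    by (subst sum_periodic_shift[symmetric]) (simp_all only: per, simp_all)
  show "period_sum Nx Ny Nz (\<lambda>i j k. f i (j + 1) k * g i j k - f i j k * g i (j + 1) k) =
         period_sum Nx Ny Nz (\<lambda>i j k. f i j k * g i (j - 1) k - f i (j - 1) k * g i j k)"
    unfolding period_sum_def
    by (rule sum.cong[OF refl], subst (2) sum_periodic_shift[symmetric]) (simp_all only: per, simp_all)
  show "period_sum Nx Ny Nz (\<lambda>i j k. f i j (k + 1) * g i j k - f i j k * g i j (k + 1)) =
         period_sum Nx Ny Nz (\<lambda>i j k. f i j k * g i j (k - 1) - f i j (k - 1) * g i j k)"
    unfolding period_sum_def
    by (rule sum.cong[OF refl], rule sum.cong[OF refl], subst (2) sum_periodic_shift[symmetric])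
       (simp_all only: per, simp_all)
qed

lemma period_sum_add:
  "period_sum Nx Ny Nz (\<lambda>i j k. f i j k + g i j k) = period_sum Nx Ny Nz f + period_sum Nx Ny Nz g"
  by (simp add: period_sum_def sum.distrib)

lemma period_sum_diff:
  "period_sum Nx Ny Nz (\<lambda>i j k. f i j k - g i j k) = period_sum Nx Ny Nz f - period_sum Nx Ny Nz g"
  by (simp add: period_sum_def sum_subtractf)

lemma period_sum_scale:
  "period_sum Nx Ny Nz (\<lambda>i j k. c * f i j k) = c * period_sum Nx Ny Nz f"
  by (simp add: period_sum_def sum_distrib_left)

lemma period_sum_divide:
  "period_sum Nx Ny Nz (\<lambda>i j k. f i j k / c) = period_sum Nx Ny Nz f / c"
  by (simp add: period_sum_def sum_divide_distrib)

lemma laplace_d_symmetric: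
  assumes "even_periodic Nx Ny Nz f" "even_periodic Nx Ny Nz g"
  shows "period_sum Nx Ny Nz (\<lambda>i j k. laplace_d dx dy dz f i j k * g i j k) =
         period_sum Nx Ny Nz (\<lambda>i j k. f i j k * laplace_d dx dy dz g i j k)"
proof -
  \<comment> \<open>Green's identity: the integrand is a sum of differences of fluxes.\<close>
  have "laplace_d dx dy dz f i j k * g i j k - f i j k * laplace_d dx dy dz g i j k =
      ((f (i + 1) j k * g i j k - f i j k * g (i + 1) j k)
        - (f i j k * g (i - 1) j k - f (i - 1) j k * g i j k)) / dx\<^sup>2
    + ((f i (j + 1) k * g i j k - f i j k * g i (j + 1) k)
        - (f i j k * g i (j - 1) k - f i (j - 1) k * g i j k)) / dy\<^sup>2
    + ((f i j (k + 1) * g i j k - f i j k * g i j (k + 1))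
        - (f i j k * g i j (k - 1) - f i j (k - 1) * g i j k)) / dz\<^sup>2" for i j k
    unfolding laplace_d_eq divide_inverse by (simp add: algebra_simps)
  then have "period_sum Nx Ny Nz (\<lambda>i j k. laplace_d dx dy dz f i j k * g i j k
      - f i j k * laplace_d dx dy dz g i j k) = 0"
    using period_sum_shift[OF assms]
    by (simp add: period_sum_add period_sum_diff period_sum_divide)
  then show ?thesis
    by (simp add: period_sum_diff)
qed

subsection \<open>The linear system of one time step\<close>

lemma laplace_d_add:
  "laplace_d dx dy dz (\<lambda>i j k. f i j k + g i j k) =
     (\<lambda>i j k. laplace_d dx dy dz f i j k + laplace_d dx dy dz g i j k)"
  by (intro ext) (simp add: laplace_d_eq divide_inverse algebra_simps)

lemma laplace_d_scale:
  "laplace_d dx dy dz (\<lambda>i j k. c * f i j k) = (\<lambda>i j k. c * laplace_d dx dy dz f i j k)"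
  by (intro ext) (simp add: laplace_d_eq divide_inverse algebra_simps)

lemma neumann_ext_add:
  "neumann_ext Nx Ny Nz (\<lambda>i j k. f i j k + g i j k) =
     (\<lambda>i j k. neumann_ext Nx Ny Nz f i j k + neumann_ext Nx Ny Nz g i j k)"
  by (simp add: neumann_ext_def)

lemma neumann_ext_scale:
  "neumann_ext Nx Ny Nz (\<lambda>i j k. c * f i j k) = (\<lambda>i j k. c * neumann_ext Nx Ny Nz f i j k)"
  by (simp add: neumann_ext_def)

text \<open>Both cases of the scheme have this implicit part and differ only in \<open>a\<close> and
  in the explicit data. The first term uses the zero-padded array and the second its extension, so
  only the values at grid indices are meaningful.\<close>

definition implicit_op ::
  "nat \<Rightarrow> nat \<Rightarrow> nat \<Rightarrow> real \<Rightarrow> real \<Rightarrow> real \<Rightarrow> real \<Rightarrow> real \<Rightarrow> grid_fun \<Rightarrow> grid_fun" where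
  "implicit_op Nx Ny Nz dx dy dz a \<epsilon> V = (\<lambda>i j k.
     a * V i j k + \<epsilon> * laplace_d dx dy dz (laplace_d dx dy dz (neumann_ext Nx Ny Nz V)) i j k)"

lemma implicit_op_add:
  "implicit_op Nx Ny Nz dx dy dz a \<epsilon> (\<lambda>i j k. f i j k + g i j k) =
     (\<lambda>i j k. implicit_op Nx Ny Nz dx dy dz a \<epsilon> f i j k + implicit_op Nx Ny Nz dx dy dz a \<epsilon> g i j k)"
  by (simp add: implicit_op_def neumann_ext_add laplace_d_add algebra_simps)

lemma implicit_op_scale:
  "implicit_op Nx Ny Nz dx dy dz a \<epsilon> (\<lambda>i j k. c * f i j k) =
     (\<lambda>i j k. c * implicit_op Nx Ny Nz dx dy dz a \<epsilon> f i j k)"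
  by (simp add: implicit_op_def neumann_ext_scale laplace_d_scale algebra_simps)

lemma implicit_op_kernel:
  assumes N: "Nx > 0" "Ny > 0" "Nz > 0" and a: "a > 0" and \<epsilon>: "\<epsilon> \<ge> 0"
    and eq: "\<And>i j k. i \<in> {0..int Nx} \<Longrightarrow> j \<in> {0..int Ny} \<Longrightarrow> k \<in> {0..int Nz} \<Longrightarrow>
               implicit_op Nx Ny Nz dx dy dz a \<epsilon> V i j k = 0"
    and ijk: "i \<in> {0..int Nx}" "j \<in> {0..int Ny}" "k \<in> {0..int Nz}"
  shows "V i j k = 0"
proof -
  define W where "W = neumann_ext Nx Ny Nz V"
  define L where "L = laplace_d dx dy dz"
  have W: "even_periodic Nx Ny Nz W"
    by (simp add: W_def even_periodic_neumann_ext)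
  then have LW: "even_periodic Nx Ny Nz (L W)"
    by (simp add: L_def even_periodic_laplace_d)
  then have LLW: "even_periodic Nx Ny Nz (L (L W))"
    by (simp add: L_def even_periodic_laplace_d)
  \<comment> \<open>The equation is known at the folded indices, which lie in the grid; there
    \<open>V\<close> gives the values of \<open>W\<close>, and \<open>L (L W)\<close> is invariant
    under folding.\<close>
  have all: "a * W i j k + \<epsilon> * L (L W) i j k = 0" for i j k
  proof -
    have "a * V (reflect Nx i) (reflect Ny j) (reflect Nz k)
        + \<epsilon> * L (L W) (reflect Nx i) (reflect Ny j) (reflect Nz k) = 0"
      using eq[OF reflect_range[OF N(1)] reflect_range[OF N(2)] reflect_range[OF N(3)]]
      by (simp add: implicit_op_def L_def W_def)
    then show ?thesis
      by (simp only: even_periodic_reflect3[OF LLW]) (simp add: W_def neumann_ext_def)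
  qed
  have "0 = period_sum Nx Ny Nz (\<lambda>i j k. W i j k * (a * W i j k + \<epsilon> * L (L W) i j k))"
    by (simp add: all period_sum_def)
  also have "\<dots> = period_sum Nx Ny Nz (\<lambda>i j k. a * (W i j k)\<^sup>2 + \<epsilon> * (W i j k * L (L W) i j k))"
    by (simp add: algebra_simps power2_eq_square)
  \<comment> \<open>Symmetry applied to \<open>W\<close> and \<open>L W\<close> moves one Laplacian
    across and turns the second term into a square.\<close>
  also have "\<dots> = a * period_sum Nx Ny Nz (\<lambda>i j k. (W i j k)\<^sup>2)
      + \<epsilon> * period_sum Nx Ny Nz (\<lambda>i j k. (L W i j k)\<^sup>2)"
    using laplace_d_symmetric[OF W LW, of dx dy dz]
    by (simp add: period_sum_add period_sum_scale L_def power2_eq_square)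
  finally have sum0: "a * period_sum Nx Ny Nz (\<lambda>i j k. (W i j k)\<^sup>2)
      + \<epsilon> * period_sum Nx Ny Nz (\<lambda>i j k. (L W i j k)\<^sup>2) = 0" by simp
  have nonneg: "period_sum Nx Ny Nz (\<lambda>i j k. (f i j k)\<^sup>2) \<ge> 0" for f
    by (simp add: period_sum_def sum_nonneg)
  have "a * period_sum Nx Ny Nz (\<lambda>i j k. (W i j k)\<^sup>2) \<le> 0"
    using sum0 mult_nonneg_nonneg[OF \<epsilon> nonneg[of "L W"]] by linarith
  then have "period_sum Nx Ny Nz (\<lambda>i j k. (W i j k)\<^sup>2) = 0"
    using a nonneg[of W] by (simp add: mult_le_0_iff)
  \<comment> \<open>The grid lies within one period because N < 2 N for positive N.\<close>
  moreover have "i \<in> {0..<2 * int Nx}" "j \<in> {0..<2 * int Ny}" "k \<in> {0..<2 * int Nz}"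
    using N ijk by auto
  ultimately have "W i j k = 0"
    by (simp add: period_sum_def sum_nonneg_eq_0_iff sum_nonneg)
  then show ?thesis
    using ijk by (simp add: W_def neumann_ext_on_grid)
qed

lemma implicit_op_surj:
  assumes N: "Nx > 0" "Ny > 0" "Nz > 0" and a: "a > 0" and \<epsilon>: "\<epsilon> \<ge> 0"
  shows "\<exists>V \<in> L2d Nx Ny Nz. \<forall>i\<in>{0..int Nx}. \<forall>j\<in>{0..int Ny}. \<forall>k\<in>{0..int Nz}.
           implicit_op Nx Ny Nz dx dy dz a \<epsilon> V i j k = F i j k"
proof -
  define S where "S = {0..int Nx} \<times> {0..int Ny} \<times> {0..int Nz}"
  define cur :: "(int \<times> int \<times> int \<Rightarrow> real) \<Rightarrow> grid_fun" where "cur = (\<lambda>f i j k. f (i, j, k))"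
  \<comment> \<open>The cut-off is essential: the squared Laplacian of the extension need not vanish
    at ghost indices. Triples replace curried indices so that the arrays become functions on a
    single index type.\<close>
  define T where "T = (\<lambda>f (i, j, k).
      if (i, j, k) \<in> S then implicit_op Nx Ny Nz dx dy dz a \<epsilon> (cur f) i j k else 0)"
  define g where "g = (\<lambda>(i, j, k). if (i, j, k) \<in> S then F i j k else 0)"
  have "\<exists>f. (\<forall>x. x \<notin> S \<longrightarrow> f x = 0) \<and> T f = g"
  proof (rule finite_support_linear_surj)
    show "finite S"
      by (simp add: S_def)
    show "T (\<lambda>x. f x + h x) = (\<lambda>x. T f x + T h x)" for f h
      using implicit_op_add[of Nx Ny Nz dx dy dz a \<epsilon> "cur f" "cur h"]
      by (auto simp: T_def cur_def fun_eq_iff)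
    show "T (\<lambda>x. c * f x) = (\<lambda>x. c * T f x)" for c f
      using implicit_op_scale[of Nx Ny Nz dx dy dz a \<epsilon> c "cur f"]
      by (auto simp: T_def cur_def fun_eq_iff)
    show "T f x = 0" if "x \<notin> S" for f x
      using that by (auto simp: T_def split: prod.split)
    show "g x = 0" if "x \<notin> S" for x
      using that by (auto simp: g_def split: prod.split)
    show "f = (\<lambda>x. 0)" if f: "\<And>x. x \<notin> S \<Longrightarrow> f x = 0" and "T f = (\<lambda>x. 0)" for f
    proof -
      have "implicit_op Nx Ny Nz dx dy dz a \<epsilon> (cur f) i j k = 0"
        if "i \<in> {0..int Nx}" "j \<in> {0..int Ny}" "k \<in> {0..int Nz}" for i j k
        using fun_cong[OF \<open>T f = (\<lambda>x. 0)\<close>, of "(i, j, k)"] that by (simp add: T_def S_def)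
      then have *: "cur f i j k = 0"
        if "i \<in> {0..int Nx}" "j \<in> {0..int Ny}" "k \<in> {0..int Nz}" for i j k
        using implicit_op_kernel[OF N a \<epsilon>] that by blast
      have "f (i, j, k) = 0" for i j k
        using f[of "(i, j, k)"] *[of i j k] by (fastforce simp: S_def cur_def)
      then show ?thesis by auto
    qed
  qed
  then obtain f where f: "\<forall>x. x \<notin> S \<longrightarrow> f x = 0" "T f = g" by blast
  have "cur f \<in> L2d Nx Ny Nz"
    using f(1) by (auto simp: L2d_def cur_def S_def)
  moreover have "implicit_op Nx Ny Nz dx dy dz a \<epsilon> (cur f) i j k = F i j k"
    if "i \<in> {0..int Nx}" "j \<in> {0..int Ny}" "k \<in> {0..int Nz}" for i j k
    using fun_cong[OF f(2), of "(i, j, k)"] that by (simp add: T_def g_def S_def)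
  ultimately show ?thesis by blast
qed

section \<open>Unique solvability of one time step\<close>

theorem theorem4p3:
  fixes lx ly lz dx dy dz \<epsilon> \<eta> dt :: real and Nx Ny Nz :: nat
  assumes "lx > 0" and "ly > 0" and "lz > 0"
    and "Nx > 0" and "Ny > 0" and "Nz > 0"
    and "dx = lx / real Nx" and "dy = ly / real Ny" and "dz = lz / real Nz"
    and "\<epsilon> > 0" and "dt > 0"
  shows "\<forall>U \<in> L2d Nx Ny Nz. \<exists>!V. V \<in> L2d Nx Ny Nz \<and>
           scheme_step Nx Ny Nz dx dy dz \<epsilon> \<eta> dt U V"
proof
  fix U
  \<comment> \<open>\<open>a\<close> collects the factors of the new array and \<open>F\<close> all
    terms in the old one. For \<eta> \<ge> 1 the linear term is explicit and enters
    \<open>F\<close>, so \<open>a\<close> stays positive for every \<eta> without a restriction on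
    \<open>dt\<close>.\<close>
  define a where "a = 1 / dt + (if \<eta> < 1 then 1 - \<eta> else 0)"
  define F where "F = (\<lambda>i j k. U i j k / dt - (U i j k) ^ 3
      - 2 * laplace_d dx dy dz (neumann_ext Nx Ny Nz U) i j k
      + (if \<eta> < 1 then 0 else (\<eta> - 1) * U i j k))"
  let ?B = "implicit_op Nx Ny Nz dx dy dz a \<epsilon>"
  have a: "a > 0"
    using \<open>dt > 0\<close> by (auto simp: a_def intro: add_pos_pos)
  have \<epsilon>: "\<epsilon> \<ge> 0"
    using \<open>\<epsilon> > 0\<close> by simp
  have step: "scheme_step Nx Ny Nz dx dy dz \<epsilon> \<eta> dt U V \<longleftrightarrow>
      (\<forall>i\<in>{0..int Nx}. \<forall>j\<in>{0..int Ny}. \<forall>k\<in>{0..int Nz}. ?B V i j k = F i j k)" for V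
    unfolding scheme_step_def Let_def implicit_op_def a_def F_def
    by (intro ball_cong refl)
       (cases "\<eta> < 1"; simp add: diff_divide_distrib distrib_right; linarith)
  obtain V where V: "V \<in> L2d Nx Ny Nz"
    "\<forall>i\<in>{0..int Nx}. \<forall>j\<in>{0..int Ny}. \<forall>k\<in>{0..int Nz}. ?B V i j k = F i j k"
    using implicit_op_surj[OF assms(4-6) a \<epsilon>, of dx dy dz F] by blast
  show "\<exists>!V. V \<in> L2d Nx Ny Nz \<and> scheme_step Nx Ny Nz dx dy dz \<epsilon> \<eta> dt U V"
  proof (rule ex1I)
    show "V \<in> L2d Nx Ny Nz \<and> scheme_step Nx Ny Nz dx dy dz \<epsilon> \<eta> dt U V"
      using V by (simp add: step)
    fix V' assume V': "V' \<in> L2d Nx Ny Nz \<and> scheme_step Nx Ny Nz dx dy dz \<epsilon> \<eta> dt U V'"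
    \<comment> \<open>The difference is written as a sum with a multiple, the form in which
      \<open>implicit_op_add\<close> and \<open>implicit_op_scale\<close> apply.\<close>
    define D where "D = (\<lambda>i j k. V' i j k + (-1) * V i j k)"
    have "?B D = (\<lambda>i j k. ?B V' i j k + (-1) * ?B V i j k)"
      unfolding D_def by (simp only: implicit_op_add implicit_op_scale)
    then have "?B D i j k = 0"
      if "i \<in> {0..int Nx}" "j \<in> {0..int Ny}" "k \<in> {0..int Nz}" for i j k
      using that V(2) V' by (simp add: step)
    then have *: "D i j k = 0"
      if "i \<in> {0..int Nx}" "j \<in> {0..int Ny}" "k \<in> {0..int Nz}" for i j k
      using implicit_op_kernel[OF assms(4-6) a \<epsilon>] that by blast
    show "V' = V"
    proof (intro ext)
      fix i j k
      show "V' i j k = V i j k"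
        \<comment> \<open>On the grid \<open>D\<close> vanishes; elsewhere both arrays are zero by
          the padding in \<open>L2d\<close>.\<close>
        using *[of i j k] V(1) V' unfolding L2d_def D_def by fastforce
    qed
  qed
qed

end
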